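(* Let $a<b$ be real numbers and let $f:[a,b]\to (0,\infty)$ be log-convex. Then for $0\leq \nu\leq 1$ and $N\in\mathbb{N}$, $$f\left((1-\nu)a+\nu b\right)\prod_{j=1}^{N}\left(\frac{f(x_j(\nu))f(y_j(\nu))}{f^2(z_j(\nu))}\right)^{A_j(\nu)}\leq f^{1-\nu}(a)f^{\nu}(b).$$
   Context: $\mathbb{N}=\{1,2,3,\dots\}$ and $[\cdot]$ denotes the integer part (floor). A function $f$ with values in $(0,\infty)$ is log-convex if $\log f$ is convex. For $0\le\nu\le 1$ and $j\in\mathbb{N}$ let $k_j(\nu)=[2^{j-1}\nu]$, $r_j(\nu)=[2^{j}\nu]$, $$A_j(\nu)=(-1)^{r_j(\nu)}2^{j-1}\nu+(-1)^{r_j(\nu)+1}\left[\frac{r_j(\nu)+1}{2}\right],$$ $$x_j(\nu)=\left(1-\tfrac{k_j(\nu)}{2^{j-1}}\right)a+\tfrac{k_j(\nu)}{2^{j-1}}b,\quad y_j(\nu)=\left(1-\tfrac{k_j(\nu)+1}{2^{j-1}}\right)a+\tfrac{k_j(\nu)+1}{2^{j-1}}b,\quad z_j(\nu)=\left(1-\tfrac{2k_j(\nu)+1}{2^{j}}\right)a+\tfrac{2k_j(\nu)+1}{2^{j}}b.$$ When $\nu=1$ the points $y_j,z_j$ lie outside $[a,b]$, but then $A_j(\nu)=0$ and the corresponding factor is read as $1$. *)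

theory Defs
  imports "HOL-Analysis.Analysis"
begin

definition log_convex_on :: "real set \<Rightarrow> (real \<Rightarrow> real) \<Rightarrow> bool" where
  "log_convex_on S f \<longleftrightarrow> (\<forall>x\<in>S. f x > 0) \<and> convex_on S (\<lambda>x. ln (f x))"

text \<open>The index \<open>j\<close> below is meant to range over \<open>j \<ge> 1\<close>, so that the subtraction
  in \<open>2 ^ (j - 1)\<close> does not truncate.\<close>

definition k_idx :: "nat \<Rightarrow> real \<Rightarrow> int" where
  "k_idx j \<nu> = \<lfloor>2 ^ (j - 1) * \<nu>\<rfloor>"

definition r_idx :: "nat \<Rightarrow> real \<Rightarrow> int" where
  "r_idx j \<nu> = \<lfloor>2 ^ j * \<nu>\<rfloor>"

definition A_coeff :: "nat \<Rightarrow> real \<Rightarrow> real" where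
  "A_coeff j \<nu> =
     (-1) powi (r_idx j \<nu>) * 2 ^ (j - 1) * \<nu>
     + (-1) powi (r_idx j \<nu> + 1) * of_int \<lfloor>(of_int (r_idx j \<nu>) + 1) / 2 :: real\<rfloor>"

definition x_pt :: "real \<Rightarrow> real \<Rightarrow> nat \<Rightarrow> real \<Rightarrow> real" where
  "x_pt a b j \<nu> =
     (1 - of_int (k_idx j \<nu>) / 2 ^ (j - 1)) * a + of_int (k_idx j \<nu>) / 2 ^ (j - 1) * b"

definition y_pt :: "real \<Rightarrow> real \<Rightarrow> nat \<Rightarrow> real \<Rightarrow> real" where
  "y_pt a b j \<nu> =
     (1 - (of_int (k_idx j \<nu>) + 1) / 2 ^ (j - 1)) * a
     + (of_int (k_idx j \<nu>) + 1) / 2 ^ (j - 1) * b"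

definition z_pt :: "real \<Rightarrow> real \<Rightarrow> nat \<Rightarrow> real \<Rightarrow> real" where
  "z_pt a b j \<nu> =
     (1 - (2 * of_int (k_idx j \<nu>) + 1) / 2 ^ j) * a
     + (2 * of_int (k_idx j \<nu>) + 1) / 2 ^ j * b"

text \<open>For \<open>\<nu> = 1\<close> the points \<open>y_pt\<close> and \<open>z_pt\<close> lie outside \<open>{a..b}\<close>, where nothing is
  known about \<open>f\<close>, while \<open>A_coeff j 1 = 0\<close>; the factor is then read as 1. The case
  distinction is needed because \<open>0 powr 0 = 0\<close>. For \<open>\<nu> < 1\<close> all three points lie in
  \<open>{a..b}\<close>, so for positive \<open>f\<close> the two branches agree when \<open>A_coeff j \<nu> = 0\<close>.\<close>

definition ref_factor :: "(real \<Rightarrow> real) \<Rightarrow> real \<Rightarrow> real \<Rightarrow> nat \<Rightarrow> real \<Rightarrow> real" where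
  "ref_factor f a b j \<nu> =
     (if A_coeff j \<nu> = 0 then 1
      else (f (x_pt a b j \<nu>) * f (y_pt a b j \<nu>) / (f (z_pt a b j \<nu>))\<^sup>2) powr A_coeff j \<nu>)"

end

theory Submission
  imports Defs
begin

text \<open>Put \<open>g t = ln (f ((1 - t) a + t b))\<close>, a convex function on \<open>{0..1}\<close>, and let \<open>L n\<close> be its
  piecewise linear interpolant at the dyadic points \<open>k / 2 ^ n\<close>. The coefficient \<open>A_coeff j \<nu>\<close> is the
  distance from \<open>2 ^ (j - 1) \<nu>\<close> to the nearest integer, so the logarithm of the \<open>j\<close>-th factor equals
  \<open>L (j - 1) \<nu> - L j \<nu>\<close>. The sum telescopes to \<open>L 0 \<nu> - L N \<nu>\<close>, and \<open>g \<nu> \<le> L N \<nu>\<close> by convexity.\<close>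

text \<open>At a grid point the weight \<open>frac\<close> is zero, so the right node drops out. In
  particular at \<open>t = 1\<close>, where that node leaves \<open>{0..1}\<close>, the value is
  \<open>g 1\<close>.\<close>

definition dyadic_interp :: "(real \<Rightarrow> real) \<Rightarrow> nat \<Rightarrow> real \<Rightarrow> real" where
  "dyadic_interp g n t =
     (1 - frac (2 ^ n * t)) * g (of_int \<lfloor>2 ^ n * t\<rfloor> / 2 ^ n)
     + frac (2 ^ n * t) * g ((of_int \<lfloor>2 ^ n * t\<rfloor> + 1) / 2 ^ n)"

text \<open>Used to pass from one dyadic level to the next: the two cases say which half of its unit
  interval contains \<open>s\<close>.\<close>

lemma floor_frac_double:
  fixes s :: real
  shows "frac s < 1 / 2 \<Longrightarrow> \<lfloor>2 * s\<rfloor> = 2 * \<lfloor>s\<rfloor>" "frac s < 1 / 2 \<Longrightarrow> frac (2 * s) = 2 * frac s"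
    and "\<not> frac s < 1 / 2 \<Longrightarrow> \<lfloor>2 * s\<rfloor> = 2 * \<lfloor>s\<rfloor> + 1"
      "\<not> frac s < 1 / 2 \<Longrightarrow> frac (2 * s) = 2 * frac s - 1"
proof -
  show lo: "\<lfloor>2 * s\<rfloor> = 2 * \<lfloor>s\<rfloor>" if "frac s < 1 / 2"
    using that by (simp add: frac_def) linarith
  show hi: "\<lfloor>2 * s\<rfloor> = 2 * \<lfloor>s\<rfloor> + 1" if "\<not> frac s < 1 / 2"
    using that by (simp add: frac_def) linarith
  show "frac (2 * s) = 2 * frac s" if "frac s < 1 / 2"
    using lo[OF that] by (simp add: frac_def)
  show "frac (2 * s) = 2 * frac s - 1" if "\<not> frac s < 1 / 2"
    using hi[OF that] by (simp add: frac_def)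
qed

text \<open>With \<open>s = 2 ^ n * \<nu>\<close>, the parity of \<open>r_idx (Suc n) \<nu>\<close>
  records the half of the unit interval in which \<open>s\<close> lies. Even parity leaves
  \<open>s\<close> minus its floor, odd parity leaves the floor plus 1 minus
  \<open>s\<close>.\<close>

lemma A_coeff_Suc:
  "A_coeff (Suc n) \<nu> = min (frac (2 ^ n * \<nu>)) (1 - frac (2 ^ n * \<nu>))"
proof -
  define s where "s = 2 ^ n * \<nu>"
  have r: "r_idx (Suc n) \<nu> = \<lfloor>2 * s\<rfloor>"
    by (simp add: r_idx_def s_def mult.assoc)
  have A: "A_coeff (Suc n) \<nu> = (-1) powi \<lfloor>2 * s\<rfloor> * s
      + (-1) powi (\<lfloor>2 * s\<rfloor> + 1) * of_int \<lfloor>(of_int \<lfloor>2 * s\<rfloor> + 1) / 2 :: real\<rfloor>"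
    by (simp add: A_coeff_def r s_def)
  show ?thesis
  proof (cases "frac s < 1 / 2")
    case True
    have "\<lfloor>(of_int (2 * \<lfloor>s\<rfloor>) + 1) / 2 :: real\<rfloor> = \<lfloor>s\<rfloor>"
      by (simp add: floor_eq_iff)
    then show ?thesis
      using True unfolding A floor_frac_double(1)[OF True] s_def[symmetric]
      by (simp add: power_int_minus_left frac_def)
  next
    case False
    have "\<lfloor>(of_int (2 * \<lfloor>s\<rfloor> + 1) + 1) / 2 :: real\<rfloor> = \<lfloor>s\<rfloor> + 1"
      by (simp add: floor_eq_iff)
    then show ?thesis
      using False unfolding A floor_frac_double(3)[OF False] s_def[symmetric]
      by (simp add: power_int_minus_left frac_def)
  qed
qed

text \<open>Refining the grid adds only the midpoint of the cell of \<open>\<nu>\<close>. The two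
  interpolants therefore differ by a tent function over that cell, scaled by a second difference of
  \<open>g\<close>.\<close>

lemma dyadic_interp_diff:
  fixes g :: "real \<Rightarrow> real"
  defines "k \<equiv> \<lambda>n \<nu>. real_of_int (k_idx (Suc n) \<nu>)"
  shows "dyadic_interp g n \<nu> - dyadic_interp g (Suc n) \<nu> =
    A_coeff (Suc n) \<nu> *
      (g (k n \<nu> / 2 ^ n) + g ((k n \<nu> + 1) / 2 ^ n) - 2 * g ((2 * k n \<nu> + 1) / 2 ^ Suc n))"
proof -
  define s where "s = 2 ^ n * \<nu>"
  have s2: "2 ^ Suc n * \<nu> = 2 * s"
    by (simp add: s_def)
  have k: "k n \<nu> = \<lfloor>s\<rfloor>"
    by (simp add: k_def k_idx_def s_def)
  \<comment> \<open>The end of the half cell that is not the midpoint has an even numerator, hence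
    is already a node of level \<open>n\<close>.\<close>
  have half: "2 * real_of_int \<lfloor>s\<rfloor> / 2 ^ Suc n = \<lfloor>s\<rfloor> / 2 ^ n"
    "(2 * real_of_int \<lfloor>s\<rfloor> + 1 + 1) / 2 ^ Suc n = (\<lfloor>s\<rfloor> + 1) / 2 ^ n"
    by (simp_all add: field_simps)
  show ?thesis
  proof (cases "frac s < 1 / 2")
    case True
    then have A: "A_coeff (Suc n) \<nu> = frac s"
      by (simp add: A_coeff_Suc s_def)
    show ?thesis
      unfolding A dyadic_interp_def s2 s_def[symmetric] floor_frac_double(1,2)[OF True] k
        of_int_mult of_int_numeral half
      by (simp add: algebra_simps)
  next
    case False
    then have A: "A_coeff (Suc n) \<nu> = 1 - frac s"
      by (simp add: A_coeff_Suc s_def)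
    show ?thesis
      unfolding A dyadic_interp_def s2 s_def[symmetric] floor_frac_double(3,4)[OF False] k
        of_int_mult of_int_add of_int_1 of_int_numeral half
      by (simp add: algebra_simps)
  qed
qed

lemma dyadic_interval:
  fixes \<nu> :: real
  assumes "0 \<le> \<nu>" "\<nu> < 1"
  shows "0 \<le> real_of_int \<lfloor>2 ^ n * \<nu>\<rfloor>" "real_of_int \<lfloor>2 ^ n * \<nu>\<rfloor> + 1 \<le> 2 ^ n"
proof -
  show "0 \<le> real_of_int \<lfloor>2 ^ n * \<nu>\<rfloor>"
    using assms by simp
  \<comment> \<open>Writing the bound as an integer turns the strict inequality into one between
    integers, which gains the 1.\<close>
  have "2 ^ n * \<nu> < of_int (2 ^ n)"
    using assms by simp
  then have "\<lfloor>2 ^ n * \<nu>\<rfloor> + 1 \<le> 2 ^ n"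
    by (simp only: floor_less_iff[symmetric])
  then have "real_of_int (\<lfloor>2 ^ n * \<nu>\<rfloor> + 1) \<le> of_int (2 ^ n)"
    by (simp only: of_int_le_iff)
  then show "real_of_int \<lfloor>2 ^ n * \<nu>\<rfloor> + 1 \<le> 2 ^ n"
    by simp
qed

text \<open>For \<open>\<nu> < 1\<close> the cell lies in \<open>{0..1}\<close> and
  \<open>\<nu>\<close> divides it in the ratio given by \<open>frac\<close>, so this is the chord
  inequality on the cell. At \<open>\<nu> = 1\<close> both sides are \<open>g 1\<close>.\<close>

lemma convex_on_le_dyadic_interp:
  assumes g: "convex_on {0..1} g" and \<nu>: "0 \<le> \<nu>" "\<nu> \<le> 1"
  shows "g \<nu> \<le> dyadic_interp g n \<nu>"
proof (cases "\<nu> = 1")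
  case True
  then show ?thesis
    by (simp add: dyadic_interp_def frac_eq_0_iff[THEN iffD2])
next
  case False
  define k where "k = real_of_int \<lfloor>2 ^ n * \<nu>\<rfloor>"
  define t where "t = frac (2 ^ n * \<nu>)"
  have k: "0 \<le> k" "k + 1 \<le> 2 ^ n"
    using \<nu> False by (auto intro!: dyadic_interval simp: k_def simp del: of_int_0_le_iff)
  have "g ((1 - t) *\<^sub>R (k / 2 ^ n) + t *\<^sub>R ((k + 1) / 2 ^ n)) \<le> dyadic_interp g n \<nu>"
    unfolding dyadic_interp_def k_def[symmetric] t_def[symmetric] using k
    by (intro convex_onD[OF g]) (auto simp: t_def frac_lt_1 less_imp_le)
  moreover have "(1 - t) *\<^sub>R (k / 2 ^ n) + t *\<^sub>R ((k + 1) / 2 ^ n) = \<nu>"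
    by (simp add: k_def t_def frac_def field_simps)
  ultimately show ?thesis
    by simp
qed

lemma segment_mem:
  fixes a b t :: real
  assumes "a < b" "0 \<le> t" "t \<le> 1"
  shows "(1 - t) * a + t * b \<in> {a..b}"
  using assms convexD_alt[of "{a..b}" a b t] by simp

lemma convex_on_segment:
  fixes a b :: real
  assumes "a < b" "convex_on {a..b} h"
  shows "convex_on {0..1} (\<lambda>t. h ((1 - t) * a + t * b))"
proof (rule convex_onI)
  fix t x y :: real
  assume t: "0 < t" "t < 1" and xy: "x \<in> {0..1}" "y \<in> {0..1}"
  let ?p = "\<lambda>u. (1 - u) * a + u * b"
  have "?p ((1 - t) *\<^sub>R x + t *\<^sub>R y) = (1 - t) *\<^sub>R ?p x + t *\<^sub>R ?p y"
    by (simp add: algebra_simps)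
  then show "h (?p ((1 - t) *\<^sub>R x + t *\<^sub>R y)) \<le> (1 - t) * h (?p x) + t * h (?p y)"
    using convex_onD[OF assms(2), of t "?p x" "?p y"] t xy segment_mem[OF assms(1)] by auto
qed simp

text \<open>The points \<open>x_pt\<close>, \<open>y_pt\<close> and \<open>z_pt\<close> are the
  images in \<open>{a..b}\<close> of the ends and the midpoint of the cell when
  \<open>\<nu> < 1\<close>, so the logarithm of the quotient is the second difference in
  \<open>dyadic_interp_diff\<close>.\<close>

lemma ref_factor_Suc:
  fixes a b \<nu> :: real and f :: "real \<Rightarrow> real"
  defines "g \<equiv> \<lambda>t. ln (f ((1 - t) * a + t * b))"
  assumes ab: "a < b" and pos: "\<And>x. x \<in> {a..b} \<Longrightarrow> f x > 0" and \<nu>: "0 \<le> \<nu>" "\<nu> \<le> 1"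
  shows "ref_factor f a b (Suc n) \<nu> = exp (dyadic_interp g n \<nu> - dyadic_interp g (Suc n) \<nu>)"
proof (cases "A_coeff (Suc n) \<nu> = 0")
  case True
  then show ?thesis
    by (simp add: ref_factor_def dyadic_interp_diff)
next
  case False
  \<comment> \<open>A nonzero coefficient rules out \<open>\<nu> = 1\<close>, so all three points
    lie where \<open>f\<close> is positive and the logarithm splits.\<close>
  have "A_coeff (Suc n) 1 = 0"
    by (simp add: A_coeff_Suc frac_eq_0_iff[THEN iffD2])
  with False \<nu> have "\<nu> < 1"
    by (cases "\<nu> = 1") auto
  define k where "k = real_of_int (k_idx (Suc n) \<nu>)"
  have k: "0 \<le> k" "k + 1 \<le> 2 ^ n"
    unfolding k_def k_idx_def diff_Suc_1 using dyadic_interval[OF \<nu>(1) \<open>\<nu> < 1\<close>] .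
  have x: "f (x_pt a b (Suc n) \<nu>) > 0" and y: "f (y_pt a b (Suc n) \<nu>) > 0"
    and z: "f (z_pt a b (Suc n) \<nu>) > 0"
    unfolding x_pt_def y_pt_def z_pt_def k_def[symmetric] using k
    by (intro pos segment_mem ab; simp add: divide_le_eq)+
  then have "ln (f (x_pt a b (Suc n) \<nu>) * f (y_pt a b (Suc n) \<nu>) / (f (z_pt a b (Suc n) \<nu>))\<^sup>2)
      = ln (f (x_pt a b (Suc n) \<nu>)) + ln (f (y_pt a b (Suc n) \<nu>)) - 2 * ln (f (z_pt a b (Suc n) \<nu>))"
    by (simp add: ln_mult ln_div ln_realpow)
  then show ?thesis
    using False x y z
    by (simp add: ref_factor_def powr_def dyadic_interp_diff g_def x_pt_def y_pt_def z_pt_def)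
qed

theorem corollary2p11:
  fixes a b \<nu> :: real and f :: "real \<Rightarrow> real" and N :: nat
  assumes "a < b"
    and "log_convex_on {a..b} f"
    and "0 \<le> \<nu>" and "\<nu> \<le> 1"
    and "N \<ge> 1"
  shows "f ((1 - \<nu>) * a + \<nu> * b) * (\<Prod>j=1..N. ref_factor f a b j \<nu>)
         \<le> f a powr (1 - \<nu>) * f b powr \<nu>"
proof -
  define g where "g = (\<lambda>t. ln (f ((1 - t) * a + t * b)))"
  have pos: "\<And>x. x \<in> {a..b} \<Longrightarrow> f x > 0" and "convex_on {a..b} (\<lambda>x. ln (f x))"
    using assms(2) by (auto simp: log_convex_on_def)
  then have g: "convex_on {0..1} g"
    using convex_on_segment[OF assms(1)] by (simp add: g_def)
  have "(\<Prod>j=1..N. ref_factor f a b j \<nu>) = (\<Prod>n<N. ref_factor f a b (Suc n) \<nu>)"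
    using prod.atLeast1_atMost_eq[of "\<lambda>j. ref_factor f a b j \<nu>" N] by simp
  also have "\<dots> = exp (\<Sum>n<N. dyadic_interp g n \<nu> - dyadic_interp g (Suc n) \<nu>)"
    unfolding g_def using ref_factor_Suc[OF assms(1) pos assms(3,4)] by (simp add: exp_sum)
  also have "\<dots> = exp (dyadic_interp g 0 \<nu> - dyadic_interp g N \<nu>)"
    by (rule arg_cong[where f = exp], rule sum_lessThan_telescope')
  finally have prod: "(\<Prod>j=1..N. ref_factor f a b j \<nu>)
      = exp (dyadic_interp g 0 \<nu> - dyadic_interp g N \<nu>)" .
  \<comment> \<open>Level 0 is the chord over \<open>{0..1}\<close>. At \<open>\<nu> = 1\<close> the
    floor jumps to 1, and \<open>g 1\<close> becomes the left node with full weight.\<close>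
  have L0: "dyadic_interp g 0 \<nu> = (1 - \<nu>) * g 0 + \<nu> * g 1"
  proof (cases "\<nu> = 1")
    case False
    then have "\<lfloor>\<nu>\<rfloor> = 0"
      using assms(3,4) by linarith
    then show ?thesis
      by (simp add: dyadic_interp_def frac_def)
  qed (simp add: dyadic_interp_def)
  have "f ((1 - \<nu>) * a + \<nu> * b) = exp (g \<nu>)"
    using pos segment_mem[OF assms(1,3,4)] by (simp add: g_def)
  then have "f ((1 - \<nu>) * a + \<nu> * b) * (\<Prod>j=1..N. ref_factor f a b j \<nu>)
      = exp (g \<nu> + (dyadic_interp g 0 \<nu> - dyadic_interp g N \<nu>))"
    by (simp only: prod exp_add)
  also have "\<dots> \<le> exp (dyadic_interp g 0 \<nu>)"
    using convex_on_le_dyadic_interp[OF g assms(3,4), of N] by simp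
  also have "\<dots> = f a powr (1 - \<nu>) * f b powr \<nu>"
    using pos[of a] pos[of b] assms(1) by (simp add: L0 powr_def exp_add) (simp add: g_def)
  finally show ?thesis .
qed

end
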